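(* Let $h\colon\mathcal{X}\to\mathcal{Y}$ be a classifier with conditional risk $r(x)=\sum_{y\in\mathcal{Y}}p(y\mid x)\,\ell(y,h(x))$, let $0<\omega\le 1$ be a target coverage, and consider the problem $$\min_{c\in[0,1]^{\mathcal{X}}}\ R_S(h,c)\quad\text{s.t.}\quad\phi(c)\ge\omega, \qquad (Q)$$ where it is assumed that the minimizer exists. Let $\beta=\inf\{a\mid\int_{\mathcal{X}_{r(x)<a}}p(x)\,dx\ge\omega\}$ and define $$c^*(x)=\begin{cases}1&\text{if } r(x)<\beta,\\ \kappa&\text{if } r(x)=\beta,\\ 0&\text{if } r(x)>\beta,\end{cases}\qquad \kappa=\begin{cases}0&\text{if }\int_{\mathcal{X}_{r(x)=\beta}}p(x)\,dx=0,\\[1mm] \dfrac{\omega-\int_{\mathcal{X}_{r(x)<\beta}}p(x)\,dx}{\int_{\mathcal{X}_{r(x)=\beta}}p(x)\,dx}&\text{otherwise.}\end{cases}$$ Then $c^*$ satisfies the conditions $$\int_{\mathcal{X}_{r(x)<\beta}}p(x)c^*(x)\,dx=\int_{\mathcal{X}_{r(x)<\beta}}p(x)\,dx,$$ $$\int_{\mathcal{X}_{r(x)=\beta}}p(x)c^*(x)\,dx=\omega-\int_{\mathcal{X}_{r(x)<\beta}}p(x)\,dx,$$ $$\int_{\mathcal{X}_{r(x)>\beta}}p(x)c^*(x)\,dx=0,$$ and hence $c^*$ is an optimal solution to $(Q)$.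
   Context: $\mathcal{X}$ is a set of inputs (a measurable space with a fixed reference measure $dx$), $\mathcal{Y}$ is a finite set of labels, $p(x,y)$ is a probability density on $\mathcal{X}\times\mathcal{Y}$ (with respect to $dx$ times counting measure), $p(x)=\sum_{y\in\mathcal{Y}}p(x,y)$ is its marginal, and $p(y\mid x)$ is the conditional distribution, so $p(x,y)=p(x)p(y\mid x)$. $\ell\colon\mathcal{Y}\times\mathcal{Y}\to[0,\infty)$ is a loss. A classifier is a function $h\colon\mathcal{X}\to\mathcal{Y}$, a selection function is a function $c\colon\mathcal{X}\to[0,1]$; all functions and sets are taken measurable. The coverage of $c$ is $\phi(c)=\int_{\mathcal{X}}p(x)c(x)\,dx$, and the selective risk of $(h,c)$ is $$R_S(h,c)=\frac{\int_{\mathcal{X}}\sum_{y\in\mathcal{Y}}p(x,y)\,\ell(y,h(x))\,c(x)\,dx}{\phi(c)},$$ defined when $\phi(c)\neq 0$. For $f\colon\mathcal{X}\to\mathbb{R}$ and $a\in\mathbb{R}$, $\mathcal{X}_{f(x)<a}=\{x\in\mathcal{X}\mid f(x)<a\}$, and similarly for $\le,=,>,\ge$. *)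

theory Defs
  imports "HOL-Probability.Probability"
begin

text \<open>
  The input space is \<open>space M\<close>, the reference measure \<open>dx\<close> is \<open>M\<close>, and the finite label set
  is a type of class \<open>finite\<close>.  In the definitions below, \<open>p x y\<close> is the joint density,
  \<open>q x y\<close> is the conditional probability of \<open>y\<close> given \<open>x\<close>, and \<open>l y y'\<close> is the loss of
  predicting \<open>y'\<close> when the label is \<open>y\<close>.
\<close>

definition joint_density :: "'x measure \<Rightarrow> ('x \<Rightarrow> 'y::finite \<Rightarrow> real) \<Rightarrow> bool" where
  "joint_density M p \<longleftrightarrow>
     (\<lambda>(x, y). p x y) \<in> borel_measurable (M \<Otimes>\<^sub>M count_space UNIV) \<and>
     (\<forall>x\<in>space M. \<forall>y. 0 \<le> p x y) \<and>
     (\<integral>\<^sup>+ (x, y). ennreal (p x y) \<partial>(M \<Otimes>\<^sub>M count_space UNIV)) = 1"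

definition marginal :: "('x \<Rightarrow> 'y::finite \<Rightarrow> real) \<Rightarrow> 'x \<Rightarrow> real" where
  "marginal p x = (\<Sum>y\<in>UNIV. p x y)"

text \<open>
  A conditional distribution is any Markov kernel that disintegrates \<open>p\<close>.  It equals
  \<open>p x y / marginal p x\<close> where the marginal is positive; elsewhere it is an arbitrary
  probability vector, so no convention for division by zero is involved.
\<close>

definition conditional_distribution ::
    "'x measure \<Rightarrow> ('x \<Rightarrow> 'y::finite \<Rightarrow> real) \<Rightarrow> ('x \<Rightarrow> 'y \<Rightarrow> real) \<Rightarrow> bool" where
  "conditional_distribution M p q \<longleftrightarrow>
     (\<forall>y. (\<lambda>x. q x y) \<in> borel_measurable M) \<and>
     (\<forall>x\<in>space M. (\<forall>y. 0 \<le> q x y) \<and> (\<Sum>y\<in>UNIV. q x y) = 1) \<and>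
     (\<forall>x\<in>space M. \<forall>y. p x y = marginal p x * q x y)"

definition selection_function :: "'x measure \<Rightarrow> ('x \<Rightarrow> real) \<Rightarrow> bool" where
  "selection_function M c \<longleftrightarrow> c \<in> borel_measurable M \<and> (\<forall>x\<in>space M. 0 \<le> c x \<and> c x \<le> 1)"

definition coverage :: "'x measure \<Rightarrow> ('x \<Rightarrow> 'y::finite \<Rightarrow> real) \<Rightarrow> ('x \<Rightarrow> real) \<Rightarrow> real" where
  "coverage M p c = (\<integral>x. marginal p x * c x \<partial>M)"

definition selective_risk ::
    "'x measure \<Rightarrow> ('x \<Rightarrow> 'y::finite \<Rightarrow> real) \<Rightarrow> ('y \<Rightarrow> 'y \<Rightarrow> real) \<Rightarrow> ('x \<Rightarrow> 'y) \<Rightarrow> ('x \<Rightarrow> real) \<Rightarrow> real" where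
  "selective_risk M p l h c =
     (\<integral>x. (\<Sum>y\<in>UNIV. p x y * l y (h x) * c x) \<partial>M) / coverage M p c"

definition conditional_risk ::
    "('x \<Rightarrow> 'y::finite \<Rightarrow> real) \<Rightarrow> ('y \<Rightarrow> 'y \<Rightarrow> real) \<Rightarrow> ('x \<Rightarrow> 'y) \<Rightarrow> 'x \<Rightarrow> real" where
  "conditional_risk q l h x = (\<Sum>y\<in>UNIV. q x y * l y (h x))"

text \<open>
  Only \<open>\<omega> > 0\<close> is used below, so every feasible \<open>c\<close> has nonzero coverage and its selective
  risk is a genuine quotient.
\<close>

definition feasible ::
    "'x measure \<Rightarrow> ('x \<Rightarrow> 'y::finite \<Rightarrow> real) \<Rightarrow> real \<Rightarrow> ('x \<Rightarrow> real) \<Rightarrow> bool" where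
  "feasible M p \<omega> c \<longleftrightarrow> selection_function M c \<and> \<omega> \<le> coverage M p c"

definition optimal_selection ::
    "'x measure \<Rightarrow> ('x \<Rightarrow> 'y::finite \<Rightarrow> real) \<Rightarrow> ('y \<Rightarrow> 'y \<Rightarrow> real) \<Rightarrow> ('x \<Rightarrow> 'y) \<Rightarrow> real \<Rightarrow>
     ('x \<Rightarrow> real) \<Rightarrow> bool" where
  "optimal_selection M p l h \<omega> c \<longleftrightarrow>
     feasible M p \<omega> c \<and>
     (\<forall>c'. feasible M p \<omega> c' \<longrightarrow> selective_risk M p l h c \<le> selective_risk M p l h c')"

text \<open>
  The infimum is taken in the reals.  For \<open>0 < \<omega> \<le> 1\<close> and a nonnegative loss the set is
  nonempty and bounded below by \<open>0\<close>, because \<open>0 \<le> r x \<le> Max (range (\<lambda>(y, y'). l y y'))\<close>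
  for the conditional risk \<open>r\<close>.
\<close>

definition risk_threshold ::
    "'x measure \<Rightarrow> ('x \<Rightarrow> 'y::finite \<Rightarrow> real) \<Rightarrow> ('x \<Rightarrow> real) \<Rightarrow> real \<Rightarrow> real" where
  "risk_threshold M p r \<omega> =
     Inf {a. \<omega> \<le> (LINT x:{x\<in>space M. r x < a}|M. marginal p x)}"

definition boundary_acceptance ::
    "'x measure \<Rightarrow> ('x \<Rightarrow> 'y::finite \<Rightarrow> real) \<Rightarrow> ('x \<Rightarrow> real) \<Rightarrow> real \<Rightarrow> real \<Rightarrow> real" where
  "boundary_acceptance M p r \<omega> \<beta> =
     (if (LINT x:{x\<in>space M. r x = \<beta>}|M. marginal p x) = 0 then 0
      else (\<omega> - (LINT x:{x\<in>space M. r x < \<beta>}|M. marginal p x)) /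
           (LINT x:{x\<in>space M. r x = \<beta>}|M. marginal p x))"

definition threshold_selection :: "('x \<Rightarrow> real) \<Rightarrow> real \<Rightarrow> real \<Rightarrow> 'x \<Rightarrow> real" where
  "threshold_selection r \<beta> \<kappa> x = (if r x < \<beta> then 1 else if r x = \<beta> then \<kappa> else 0)"

end

theory Submission
  imports Defs
begin

text \<open>
  With respect to the probability measure \<open>density M (marginal p)\<close> the coverage of \<open>c\<close> is the
  expectation of \<open>c\<close>, and its selective risk is the expectation of \<open>r * c\<close> divided by that of
  \<open>c\<close>.  Continuity of measure at \<open>\<beta>\<close> gives \<open>P(r < \<beta>) \<le> \<omega> \<le> P(r \<le> \<beta>)\<close>, so the threshold
  selection \<open>t\<close> has coverage exactly \<open>\<omega>\<close>.  The pointwise inequality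
  \<open>(r - \<beta>) * (c - t) \<ge> 0\<close> yields \<open>E[r c] \<ge> E[r t] + \<beta> * (E[c] - \<omega>)\<close>, and
  \<open>E[r t] \<le> \<beta> * \<omega>\<close> turns this into a comparison of the quotients.
\<close>

section \<open>Quantiles and threshold selections on a probability space\<close>

lemma threshold_selection_measurable [measurable]:
  assumes [measurable]: "r \<in> borel_measurable N"
  shows "threshold_selection r \<beta> \<kappa> \<in> borel_measurable N"
  unfolding threshold_selection_def [abs_def] by measurable

context prob_space
begin

text \<open>The event \<open>r < \<beta>\<close> is an increasing union of events
  \<open>r < a\<close> with \<open>a\<close> strictly below the infimum, and
  \<open>r \<le> \<beta>\<close> is a decreasing intersection of such events with \<open>a\<close>
  strictly above it. Either inequality can be strict when \<open>r\<close> has an atom at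
  \<open>\<beta>\<close>. The bounds \<open>a0\<close> and \<open>a1\<close> make the set under
  \<open>Inf\<close> bounded below and nonempty, so the infimum is genuine.\<close>

lemma quantile_bounds:
  fixes r :: "'a \<Rightarrow> real"
  assumes [measurable]: "r \<in> borel_measurable M"
    and bdd: "\<And>x. x \<in> space M \<Longrightarrow> a0 \<le> r x \<and> r x < a1"
    and "0 < \<omega>" "\<omega> \<le> 1"
    and \<beta>: "\<beta> = Inf {a. \<omega> \<le> prob {x \<in> space M. r x < a}}"
  shows "prob {x \<in> space M. r x < \<beta>} \<le> \<omega>" "\<omega> \<le> prob {x \<in> space M. r x \<le> \<beta>}"
proof -
  define S where "S = {a. \<omega> \<le> prob {x \<in> space M. r x < a}}"
  have \<beta>S: "\<beta> = Inf S"
    by (simp add: S_def \<beta>)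
  have "{x \<in> space M. r x < a1} = space M"
    using bdd by auto
  then have "a1 \<in> S"
    using \<open>\<omega> \<le> 1\<close> by (simp add: S_def prob_space)
  have lower: "a0 \<le> a" if "a \<in> S" for a
  proof (rule ccontr)
    assume "\<not> a0 \<le> a"
    then have "{x \<in> space M. r x < a} = {}"
      using bdd by force
    then have "prob {x \<in> space M. r x < a} = 0"
      by (simp only: measure_empty)
    then show False
      using that \<open>0 < \<omega>\<close> by (simp add: S_def)
  qed
  then have "bdd_below S"
    by (rule bdd_belowI)
  have below: "prob {x \<in> space M. r x < a} \<le> \<omega>" if "a < \<beta>" for a
  proof (rule ccontr)
    assume "\<not> ?thesis"
    then have "a \<in> S"
      by (simp add: S_def)
    then show False
      using cInf_lower [OF _ \<open>bdd_below S\<close>] that \<beta>S by fastforce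
  qed
  \<comment> \<open>The infimum need not belong to \<open>S\<close>, so the bound is taken from a
    member \<open>b\<close> of \<open>S\<close> below \<open>a\<close> and carried to
    \<open>a\<close> by monotonicity.\<close>
  have above: "\<omega> \<le> prob {x \<in> space M. r x < a}" if "\<beta> < a" for a
  proof -
    obtain b where "b \<in> S" "b < a"
      using cInf_lessD [of S a] \<open>a1 \<in> S\<close> \<open>\<beta> < a\<close> \<beta>S by blast
    then have "\<omega> \<le> prob {x \<in> space M. r x < b}"
      by (simp add: S_def)
    also have "\<dots> \<le> prob {x \<in> space M. r x < a}"
      using \<open>b < a\<close> by (intro finite_measure_mono) auto
    finally show ?thesis .
  qed
  \<comment> \<open>A positive null sequence to approach \<open>\<beta>\<close> from both sides; its
    monotonicity makes the events nested.\<close>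
  define e where "e = (\<lambda>n. inverse (real (Suc n)))"
  have e_pos: "0 < e n" for n
    by (simp add: e_def)
  have e_mono: "e n \<le> e m" if "m \<le> n" for m n
    using that by (simp add: e_def)
  have e_small: "\<exists>n. e n < d" if "0 < d" for d
    using reals_Archimedean [OF that] by (simp add: e_def)
  have "(\<lambda>n. prob {x \<in> space M. r x < \<beta> - e n})
      \<longlonglongrightarrow> prob (\<Union>n. {x \<in> space M. r x < \<beta> - e n})"
  proof (rule finite_Lim_measure_incseq)
    show "incseq (\<lambda>n. {x \<in> space M. r x < \<beta> - e n})"
      using e_mono by (force simp: incseq_def)
  qed auto
  moreover have "(\<Union>n. {x \<in> space M. r x < \<beta> - e n}) = {x \<in> space M. r x < \<beta>}"
  proof -
    have "(\<exists>n. r x < \<beta> - e n) \<longleftrightarrow> r x < \<beta>" for x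
    proof
      assume "r x < \<beta>"
      then show "\<exists>n. r x < \<beta> - e n"
        using e_small [of "\<beta> - r x"] by (auto simp: algebra_simps)
    next
      assume "\<exists>n. r x < \<beta> - e n"
      then obtain n where "r x < \<beta> - e n" ..
      then show "r x < \<beta>"
        using e_pos [of n] by simp
    qed
    then show ?thesis
      by blast
  qed
  ultimately have "(\<lambda>n. prob {x \<in> space M. r x < \<beta> - e n})
      \<longlonglongrightarrow> prob {x \<in> space M. r x < \<beta>}"
    by simp
  then show "prob {x \<in> space M. r x < \<beta>} \<le> \<omega>"
    by (rule LIMSEQ_le_const2) (simp add: below e_pos)
  have "(\<lambda>n. prob {x \<in> space M. r x < \<beta> + e n})
      \<longlonglongrightarrow> prob (\<Inter>n. {x \<in> space M. r x < \<beta> + e n})"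
  proof (rule finite_Lim_measure_decseq)
    show "decseq (\<lambda>n. {x \<in> space M. r x < \<beta> + e n})"
      using e_mono by (force simp: decseq_def)
  qed auto
  moreover have "(\<Inter>n. {x \<in> space M. r x < \<beta> + e n}) = {x \<in> space M. r x \<le> \<beta>}"
  proof -
    have "(\<forall>n. r x < \<beta> + e n) \<longleftrightarrow> r x \<le> \<beta>" for x
    proof
      assume *: "\<forall>n. r x < \<beta> + e n"
      show "r x \<le> \<beta>"
      proof (rule ccontr)
        assume "\<not> r x \<le> \<beta>"
        then obtain n where "e n < r x - \<beta>"
          using e_small [of "r x - \<beta>"] by auto
        moreover have "r x < \<beta> + e n"
          using * ..
        ultimately show False
          by simp
      qed
    next
      assume "r x \<le> \<beta>"
      then show "\<forall>n. r x < \<beta> + e n"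
        using e_pos by (smt (verit))
    qed
    then show ?thesis
      by blast
  qed
  ultimately have "(\<lambda>n. prob {x \<in> space M. r x < \<beta> + e n})
      \<longlonglongrightarrow> prob {x \<in> space M. r x \<le> \<beta>}"
    by simp
  then show "\<omega> \<le> prob {x \<in> space M. r x \<le> \<beta>}"
    by (rule LIMSEQ_le_const) (simp add: above e_pos)
qed

text \<open>Here \<open>\<beta>\<close> is any level: a threshold selection is optimal among all
  selections with at least its own coverage. Each unit of coverage beyond that of \<open>t\<close>
  costs at least \<open>\<beta>\<close>, while the average risk under \<open>t\<close> is at most
  \<open>\<beta>\<close>, so extra coverage cannot lower the quotient.\<close>

lemma threshold_selection_optimal:
  fixes r c :: "'a \<Rightarrow> real"
    and \<beta> \<kappa> :: real
  defines "t \<equiv> threshold_selection r \<beta> \<kappa>"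
  assumes [simp]: "integrable M r"
    and [measurable]: "c \<in> borel_measurable M"
    and c: "\<And>x. x \<in> space M \<Longrightarrow> 0 \<le> c x \<and> c x \<le> 1"
    and \<kappa>: "0 \<le> \<kappa>" "\<kappa> \<le> 1"
    and "0 < expectation t" and cov: "expectation t \<le> expectation c"
  shows "(LINT x|M. r x * t x) / expectation t \<le> (LINT x|M. r x * c x) / expectation c"
proof -
  have [measurable]: "r \<in> borel_measurable M"
    by (rule borel_measurable_integrable) simp
  have [measurable]: "t \<in> borel_measurable M"
    unfolding t_def by measurable
  have t: "0 \<le> t x \<and> t x \<le> 1" for x
    using \<kappa> by (simp add: t_def threshold_selection_def)
  have int: "integrable M u" "integrable M (\<lambda>x. r x * u x)"
    if [measurable]: "u \<in> borel_measurable M"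
      and u: "\<And>x. x \<in> space M \<Longrightarrow> 0 \<le> u x \<and> u x \<le> 1" for u
  proof -
    show "integrable M u"
      using u by (intro integrable_const_bound [where B = 1]) auto
    show "integrable M (\<lambda>x. r x * u x)"
      using u
      by (intro Bochner_Integration.integrable_bound [OF \<open>integrable M r\<close>])
        (auto simp: abs_mult intro!: mult_left_le)
  qed
  have [simp]: "integrable M t" "integrable M (\<lambda>x. r x * t x)"
      "integrable M c" "integrable M (\<lambda>x. r x * c x)"
    using int [of t] int [of c] t c by auto
  define A B \<omega> \<phi> where "A = (LINT x|M. r x * t x)" and "B = (LINT x|M. r x * c x)"
    and "\<omega> = expectation t" and "\<phi> = expectation c"
  \<comment> \<open>Holds pointwise because \<open>t\<close> vanishes where \<open>r\<close> exceeds
    \<open>\<beta>\<close>.\<close>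
  have "A \<le> (LINT x|M. \<beta> * t x)"
    unfolding A_def
  proof (rule integral_mono)
    show "r x * t x \<le> \<beta> * t x" for x
      using \<kappa> by (simp add: t_def threshold_selection_def)
  qed simp_all
  then have A: "A \<le> \<beta> * \<omega>"
    by (simp add: \<omega>_def)
  \<comment> \<open>The two factors never have opposite signs: \<open>t\<close> is 1, the largest
    admissible value, where \<open>r < \<beta>\<close>, and 0, the smallest, where
    \<open>r > \<beta>\<close>.\<close>
  have "0 \<le> (LINT x|M. (r x - \<beta>) * (c x - t x))"
  proof (rule integral_nonneg_AE, rule AE_I2)
    fix x assume "x \<in> space M"
    with c [of x] show "0 \<le> (r x - \<beta>) * (c x - t x)"
      by (auto simp: t_def threshold_selection_def intro: mult_nonneg_nonneg mult_nonpos_nonpos)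
  qed
  also have "\<dots> = (LINT x|M. (r x * c x - r x * t x) - (\<beta> * c x - \<beta> * t x))"
    by (intro Bochner_Integration.integral_cong) (auto simp: algebra_simps)
  also have "\<dots> = (B - A) - (\<beta> * \<phi> - \<beta> * \<omega>)"
    by (simp add: A_def B_def \<omega>_def \<phi>_def)
  finally have B: "A + \<beta> * (\<phi> - \<omega>) \<le> B"
    by (simp add: algebra_simps)
  have pos: "0 < \<omega>" "\<omega> \<le> \<phi>"
    using assms by (auto simp: \<omega>_def \<phi>_def)
  \<comment> \<open>The average risk \<open>A / \<omega>\<close> can thus replace
    \<open>\<beta>\<close> as the price of the surplus \<open>\<phi> - \<omega>\<close>, and
    \<open>A + A / \<omega> * (\<phi> - \<omega>)\<close> collapses to
    \<open>A / \<omega> * \<phi>\<close>.\<close>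
  have "A / \<omega> \<le> \<beta>"
    using A pos by (simp add: field_simps)
  then have "A / \<omega> * (\<phi> - \<omega>) \<le> \<beta> * (\<phi> - \<omega>)"
    using pos by (intro mult_right_mono) auto
  then have "A / \<omega> * \<phi> \<le> B"
    using B pos by (simp add: right_diff_distrib)
  then have "A / \<omega> \<le> B / \<phi>"
    using pos by (simp add: pos_le_divide_eq)
  then show ?thesis
    by (simp add: A_def B_def \<omega>_def \<phi>_def)
qed

text \<open>On each of the three regions \<open>t\<close> is constant. The first three values become
  the integral conditions on \<open>cstar\<close>, the last one its coverage.\<close>

lemma set_integral_threshold_selection:
  fixes r :: "'a \<Rightarrow> real"
    and \<beta> \<kappa> :: real
  assumes [measurable]: "r \<in> borel_measurable M"
  defines "t \<equiv> threshold_selection r \<beta> \<kappa>"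
  shows "(LINT x:{x \<in> space M. r x < \<beta>}|M. t x) = prob {x \<in> space M. r x < \<beta>}"
    and "(LINT x:{x \<in> space M. r x = \<beta>}|M. t x) = \<kappa> * prob {x \<in> space M. r x = \<beta>}"
    and "(LINT x:{x \<in> space M. r x > \<beta>}|M. t x) = 0"
    and "expectation t = prob {x \<in> space M. r x < \<beta>} + \<kappa> * prob {x \<in> space M. r x = \<beta>}"
proof -
  let ?L = "{x \<in> space M. r x < \<beta>}" and ?E = "{x \<in> space M. r x = \<beta>}"
  have "(LINT x:?L|M. t x) = (LINT x|M. indicator ?L x)"
    unfolding set_lebesgue_integral_def t_def threshold_selection_def
    by (intro Bochner_Integration.integral_cong) (auto simp: indicator_def)
  then show "(LINT x:?L|M. t x) = prob ?L"
    by simp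
  have "(LINT x:?E|M. t x) = (LINT x|M. \<kappa> * indicator ?E x)"
    unfolding set_lebesgue_integral_def t_def threshold_selection_def
    by (intro Bochner_Integration.integral_cong) (auto simp: indicator_def)
  then show "(LINT x:?E|M. t x) = \<kappa> * prob ?E"
    by simp
  have "(LINT x:{x \<in> space M. r x > \<beta>}|M. t x) = (LINT x|M. 0)"
    unfolding set_lebesgue_integral_def t_def threshold_selection_def
    by (intro Bochner_Integration.integral_cong) (auto simp: indicator_def)
  then show "(LINT x:{x \<in> space M. r x > \<beta>}|M. t x) = 0"
    by simp
  have "expectation t = (LINT x|M. indicator ?L x + \<kappa> * indicator ?E x)"
    unfolding t_def threshold_selection_def
    by (intro Bochner_Integration.integral_cong) (auto simp: indicator_def)
  also have "\<dots> = prob ?L + \<kappa> * prob ?E"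
    by (subst Bochner_Integration.integral_add) (auto simp: fmeasurable_eq_sets less_top [symmetric])
  finally show "expectation t = prob ?L + \<kappa> * prob ?E" .
qed

end

section \<open>From the joint density to the marginal probability measure\<close>

lemma joint_density_measurable:
  assumes "joint_density M p"
  shows "(\<lambda>x. p x y) \<in> borel_measurable M"
proof -
  have [measurable]: "(\<lambda>(x, y). p x y) \<in> borel_measurable (M \<Otimes>\<^sub>M count_space UNIV)"
    using assms by (simp add: joint_density_def)
  have "(\<lambda>x. (\<lambda>(x, y). p x y) (x, y)) \<in> borel_measurable M"
    by measurable
  then show ?thesis
    by simp
qed

lemma marginal_nonneg:
  assumes "joint_density M p" "x \<in> space M"
  shows "0 \<le> marginal p x"
  using assms by (auto simp: joint_density_def marginal_def intro: sum_nonneg)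

lemma marginal_measurable:
  assumes "joint_density M p"
  shows "marginal p \<in> borel_measurable M"
  unfolding marginal_def [abs_def]
  by (intro borel_measurable_sum joint_density_measurable [OF assms])

text \<open>By Tonelli, integrating the label out of the joint density leaves the marginal; the
  counting measure on the finite label type is sigma-finite.\<close>

lemma prob_space_marginal:
  fixes p :: "'x \<Rightarrow> 'y::finite \<Rightarrow> real"
  assumes p: "joint_density M p"
  shows "prob_space (density M (marginal p))"
proof (rule prob_spaceI)
  interpret C: sigma_finite_measure "count_space (UNIV :: 'y set)"
    by (intro sigma_finite_measure_count_space_finite) simp
  have [measurable]: "(\<lambda>(x, y). p x y) \<in> borel_measurable (M \<Otimes>\<^sub>M count_space UNIV)"
    using p by (simp add: joint_density_def)
  have [measurable]: "marginal p \<in> borel_measurable M"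
    by (rule marginal_measurable [OF p])
  have "emeasure (density M (marginal p)) (space (density M (marginal p)))
      = (\<integral>\<^sup>+ x. ennreal (marginal p x) \<partial>M)"
    by (subst emeasure_density) (auto intro!: nn_integral_cong)
  also have "\<dots> = (\<integral>\<^sup>+ x. \<integral>\<^sup>+ y. (\<lambda>(x, y). ennreal (p x y)) (x, y) \<partial>count_space UNIV \<partial>M)"
    using p by (intro nn_integral_cong)
      (auto simp: marginal_def nn_integral_count_space_finite joint_density_def sum_ennreal)
  also have "\<dots> = (\<integral>\<^sup>+ (x, y). ennreal (p x y) \<partial>(M \<Otimes>\<^sub>M count_space UNIV))"
    by (rule C.nn_integral_fst) measurable
  also have "\<dots> = 1"
    using p by (simp add: joint_density_def)
  finally show "emeasure (density M (marginal p)) (space (density M (marginal p))) = 1" .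
qed

lemma conditional_risk_measurable:
  assumes "conditional_distribution M p q" and [measurable]: "h \<in> measurable M (count_space UNIV)"
  shows "conditional_risk q l h \<in> borel_measurable M"
proof -
  have [measurable]: "(\<lambda>x. q x y) \<in> borel_measurable M" for y
    using assms by (simp add: conditional_distribution_def)
  show ?thesis
    unfolding conditional_risk_def [abs_def] by measurable
qed

text \<open>The conditional risk is a convex combination of finitely many nonnegative losses.
  Boundedness makes the threshold a genuine infimum and the risk integrable.\<close>

lemma conditional_risk_bounds:
  assumes q: "conditional_distribution M p q" and l: "\<And>y y'. 0 \<le> l y y'" and x: "x \<in> space M"
  shows "0 \<le> conditional_risk q l h x"
    and "conditional_risk q l h x \<le> Max (range (case_prod l))"
proof -
  have q0: "0 \<le> q x y" and q1: "(\<Sum>y\<in>UNIV. q x y) = 1" for y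
    using q x by (auto simp: conditional_distribution_def)
  show "0 \<le> conditional_risk q l h x"
    using q0 l by (auto simp: conditional_risk_def intro!: sum_nonneg)
  have "l y y' \<le> Max (range (case_prod l))" for y y'
    by (rule Max_ge) (auto intro: range_eqI [of _ _ "(y, y')"])
  then have "conditional_risk q l h x \<le> (\<Sum>y\<in>UNIV. q x y * Max (range (case_prod l)))"
    unfolding conditional_risk_def using q0 by (intro sum_mono mult_left_mono) auto
  also have "\<dots> = Max (range (case_prod l))"
    by (simp add: q1 flip: sum_distrib_right)
  finally show "conditional_risk q l h x \<le> Max (range (case_prod l))" .
qed

lemma integral_density_marginal:
  assumes p: "joint_density M p" and [measurable]: "f \<in> borel_measurable M"
  shows "(LINT x|M. marginal p x * f x) = (LINT x|density M (marginal p). f x)"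
  using marginal_nonneg [OF p] marginal_measurable [OF p]
  by (subst integral_density) auto

lemma set_integral_density_marginal:
  fixes f :: "'x \<Rightarrow> real"
  assumes p: "joint_density M p" and [measurable]: "f \<in> borel_measurable M" "A \<in> sets M"
  shows "(LINT x:A|M. marginal p x * f x) = (LINT x:A|density M (marginal p). f x)"
proof -
  have "(LINT x:A|M. marginal p x * f x) = (LINT x|M. marginal p x * (indicator A x * f x))"
    by (simp add: set_lebesgue_integral_def mult.left_commute)
  also have "\<dots> = (LINT x:A|density M (marginal p). f x)"
    by (subst integral_density_marginal [OF p]) (auto simp: set_lebesgue_integral_def)
  finally show ?thesis .
qed

lemma set_integral_marginal:
  assumes p: "joint_density M p" and "A \<in> sets M"
  shows "(LINT x:A|M. marginal p x) = measure (density M (marginal p)) A"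
proof -
  have "A \<inter> space M = A"
    using assms by (simp add: sets.Int_space_eq2)
  then show ?thesis
    using set_integral_density_marginal [OF p _ \<open>A \<in> sets M\<close>, of "\<lambda>_. 1"]
    by (simp add: set_lebesgue_integral_def)
qed

text \<open>Since \<open>p x y = marginal p x * q x y\<close> pointwise, the sum over labels
  collapses to the marginal times the conditional risk, and the marginal is absorbed into the
  measure.\<close>

lemma selective_risk_eq:
  assumes p: "joint_density M p" and q: "conditional_distribution M p q"
    and h [measurable]: "h \<in> measurable M (count_space UNIV)"
    and [measurable]: "c \<in> borel_measurable M"
  shows "selective_risk M p l h c =
    (LINT x|density M (marginal p). conditional_risk q l h x * c x) /
    (LINT x|density M (marginal p). c x)"
proof -
  have [measurable]: "conditional_risk q l h \<in> borel_measurable M"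
    by (rule conditional_risk_measurable [OF q h])
  have "(LINT x|M. (\<Sum>y\<in>UNIV. p x y * l y (h x) * c x))
      = (LINT x|M. marginal p x * (conditional_risk q l h x * c x))"
  proof (rule Bochner_Integration.integral_cong [OF refl])
    fix x assume "x \<in> space M"
    then have "p x y = marginal p x * q x y" for y
      using q by (simp add: conditional_distribution_def)
    then have "(\<Sum>y\<in>UNIV. p x y * l y (h x) * c x)
        = (\<Sum>y\<in>UNIV. marginal p x * (q x y * l y (h x) * c x))"
      by (intro sum.cong) (auto simp: mult.assoc)
    then show "(\<Sum>y\<in>UNIV. p x y * l y (h x) * c x)
        = marginal p x * (conditional_risk q l h x * c x)"
      by (simp add: conditional_risk_def sum_distrib_left sum_distrib_right)
  qed
  then show ?thesis
    by (simp add: selective_risk_def coverage_def integral_density_marginal [OF p])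
qed

section \<open>The threshold selection at the risk quantile and its optimality\<close>

theorem theorem6:
  fixes M :: "'x measure"
    and p q :: "'x \<Rightarrow> 'y::finite \<Rightarrow> real"
    and l :: "'y \<Rightarrow> 'y \<Rightarrow> real"
    and h :: "'x \<Rightarrow> 'y"
    and \<omega> \<beta> \<kappa> :: real
    and r cstar :: "'x \<Rightarrow> real"
  assumes "joint_density M p"
    and "conditional_distribution M p q"
    and "\<And>y y'. 0 \<le> l y y'"
    and "h \<in> measurable M (count_space UNIV)"
    and "0 < \<omega>" and "\<omega> \<le> 1"
    and "\<exists>c. optimal_selection M p l h \<omega> c"
    and "r = conditional_risk q l h"
    and "\<beta> = risk_threshold M p r \<omega>"
    and "\<kappa> = boundary_acceptance M p r \<omega> \<beta>"
    and "cstar = threshold_selection r \<beta> \<kappa>"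
  shows "(LINT x:{x\<in>space M. r x < \<beta>}|M. marginal p x * cstar x) =
           (LINT x:{x\<in>space M. r x < \<beta>}|M. marginal p x) \<and>
         (LINT x:{x\<in>space M. r x = \<beta>}|M. marginal p x * cstar x) =
           \<omega> - (LINT x:{x\<in>space M. r x < \<beta>}|M. marginal p x) \<and>
         (LINT x:{x\<in>space M. r x > \<beta>}|M. marginal p x * cstar x) = 0 \<and>
         optimal_selection M p l h \<omega> cstar"
proof -
  note p = assms(1) and q = assms(2) and h [measurable] = assms(4)
  define P where "P = density M (marginal p)"
  interpret P: prob_space P
    unfolding P_def by (rule prob_space_marginal [OF p])
  have [simp]: "space P = space M" and [measurable_cong, simp]: "sets P = sets M"
    by (simp_all add: P_def)
  have r [measurable]: "r \<in> borel_measurable M"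
    unfolding assms(8) by (rule conditional_risk_measurable [OF q h])
  have rP: "r \<in> borel_measurable P"
    by measurable
  have bounds: "0 \<le> r x \<and> r x \<le> Max (range (case_prod l))" if "x \<in> space M" for x
    using conditional_risk_bounds [of M p q l, OF q assms(3) that] by (simp add: assms(8))
  have cstar [measurable]: "cstar \<in> borel_measurable M"
    unfolding assms(11) by measurable
  let ?L = "{x \<in> space M. r x < \<beta>}" and ?E = "{x \<in> space M. r x = \<beta>}"
  \<comment> \<open>The threshold is a quantile of \<open>r\<close> under \<open>P\<close>.\<close>
  have \<beta>: "\<beta> = Inf {a. \<omega> \<le> P.prob {x \<in> space P. r x < a}}"
    by (simp add: assms(9) risk_threshold_def set_integral_marginal [OF p] P_def)
  \<comment> \<open>The upper bound on \<open>r\<close> has to be strict, hence the added 1.\<close>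
  have quantile: "P.prob ?L \<le> \<omega>" "\<omega> \<le> P.prob {x \<in> space M. r x \<le> \<beta>}"
    using P.quantile_bounds [OF rP _ \<open>0 < \<omega>\<close> \<open>\<omega> \<le> 1\<close> \<beta>, of 0 "Max (range (case_prod l)) + 1"]
      bounds by (force simp: less_eq_real_def)+
  \<comment> \<open>Splitting off the level set at \<open>\<beta>\<close> places the missing
    coverage \<open>\<omega> - P.prob ?L\<close> between 0 and \<open>P.prob ?E\<close>, which is
    why \<open>\<kappa>\<close> lies in the unit interval.\<close>
  have "P.prob {x \<in> space M. r x \<le> \<beta>} = P.prob (?L \<union> ?E)"
    by (intro arg_cong [where f = P.prob]) auto
  also have "\<dots> = P.prob ?L + P.prob ?E"
    by (rule P.finite_measure_Union) auto
  finally have le: "\<omega> \<le> P.prob ?L + P.prob ?E"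
    using quantile by simp
  have \<kappa>: "\<kappa> = (if P.prob ?E = 0 then 0 else (\<omega> - P.prob ?L) / P.prob ?E)"
    by (simp add: assms(10) boundary_acceptance_def set_integral_marginal [OF p] P_def)
  \<comment> \<open>If \<open>?E\<close> is null, the quantile bounds force
    \<open>P.prob ?L = \<omega>\<close>, so the default value 0 of \<open>\<kappa>\<close> still
    satisfies the equation.\<close>
  have \<kappa>E: "\<kappa> * P.prob ?E = \<omega> - P.prob ?L"
    using quantile le by (auto simp: \<kappa>)
  have \<kappa>01: "0 \<le> \<kappa>" "\<kappa> \<le> 1"
    using quantile le measure_nonneg [of P ?E] by (auto simp: \<kappa> divide_le_eq)
  note t = P.set_integral_threshold_selection [OF rP, of \<beta> \<kappa>, folded assms(11), simplified]
  \<comment> \<open>The coverage constraint is tight at \<open>cstar\<close>, so every feasible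
    selection covers at least as much as \<open>cstar\<close>.\<close>
  have cov: "P.expectation cstar = \<omega>"
    using t \<kappa>E by simp
  have coverage: "coverage M p c = P.expectation c" if "c \<in> borel_measurable M" for c
    unfolding coverage_def P_def by (rule integral_density_marginal [OF p that])
  have "feasible M p \<omega> cstar"
    using \<kappa>01 cov
    by (auto simp: feasible_def selection_function_def coverage)
      (auto simp: assms(11) threshold_selection_def)
  moreover have "selective_risk M p l h cstar \<le> selective_risk M p l h c"
    if c: "feasible M p \<omega> c" for c
  proof -
    have c_meas [measurable]: "c \<in> borel_measurable M"
      and c01: "\<And>x. x \<in> space M \<Longrightarrow> 0 \<le> c x \<and> c x \<le> 1" and "\<omega> \<le> P.expectation c"
      using c by (auto simp: feasible_def selection_function_def coverage)
    have "integrable P r"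
      using bounds rP
      by (intro P.integrable_const_bound [where B = "Max (range (case_prod l))"]) auto
    then have "P.expectation (\<lambda>x. r x * cstar x) / P.expectation cstar
        \<le> P.expectation (\<lambda>x. r x * c x) / P.expectation c"
      unfolding assms(11) using c01 \<kappa>01 \<open>\<omega> \<le> P.expectation c\<close> cov \<open>0 < \<omega>\<close>
      by (intro P.threshold_selection_optimal) (auto simp: assms(11))
    then show ?thesis
      by (simp add: selective_risk_eq [OF p q h] c_meas cstar P_def assms(8))
  qed
  ultimately have "optimal_selection M p l h \<omega> cstar"
    by (simp add: optimal_selection_def)
  with t \<kappa>E show ?thesis
    by (simp add: set_integral_density_marginal [OF p] set_integral_marginal [OF p] flip: P_def)
qed

end
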